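(* Let $d\ge 2$ be an integer, let $L\in\mathbb{N}_0$, and let $\mathcal{H}_{L,2}(\mathbb{S}^{d-1})=\bigoplus_{\ell\le L,\ \ell\equiv L \pmod 2}\mathrm{Harm}_\ell(\mathbb{S}^{d-1})$ be the direct sum of the harmonic spaces of even, respectively odd, degree up to $L$. Then for all $f\in C^{L+1}(\mathbb{S}^{d-1})$ and all $y\in\mathbb{S}^{d-1}$, the error of the local best approximation of $f$ on the spherical cap $C_\delta(y)$ from $\mathcal{H}_{L,2}(\mathbb{S}^{d-1})$ satisfies $$E_\delta\big(\mathcal{H}_{L,2}(\mathbb{S}^{d-1}),f,y\big)=\mathcal{O}(\delta^{L+1})\qquad\text{as }\delta\to 0 .$$
   Context: $\mathbb{S}^{d-1}=\{y\in\mathbb{R}^d : \|y\|_2=1\}$. Functions take values in $\mathbb{K}\in\{\mathbb{R},\mathbb{C}\}$, and all function and polynomial spaces are linear spaces over the same field $\mathbb{K}$ that $f$ maps into. $C^{L+1}(\mathbb{S}^{d-1})$ denotes the $\mathbb{K}$-valued functions on the sphere that are $L+1$ times continuously differentiable. $\mathrm{Hom}_\ell(\mathbb{R}^d)$ is the space of homogeneous polynomials of degree $\ell$ on $\mathbb{R}^d$ (including $0$), and $\mathrm{Harm}_\ell(\mathbb{S}^{d-1})=\{h|_{\mathbb{S}^{d-1}} : h\in\mathrm{Hom}_\ell(\mathbb{R}^d),\ \Delta_d h\equiv 0\}$, where $\Delta_d$ is the Laplace operator in $d$ dimensions. In the direct sum, $\ell$ ranges over nonnegative integers. The great circle distance is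 $d(y,z)=\arccos(\langle y,z\rangle)$, and $C_\delta(y)=\{z\in\mathbb{S}^{d-1} : d(y,z)<\delta\}$ is the open spherical cap. For a function space $\mathcal{G}$ on the sphere, $E_\delta(\mathcal{G},f,y)=\inf_{g\in\mathcal{G}}\sup_{z\in C_\delta(y)}|f(z)-g(z)|$. *)

theory Defs
  imports "HOL-Analysis.Analysis" "HOL-Library.Landau_Symbols" "HOL-Library.FuncSet"
begin

text \<open>
  The ambient space \<open>\<real>\<^sup>d\<close> is \<open>real ^ 'd\<close>, and the unit sphere is \<open>sphere 0 1\<close>. The scalar field is a
  type \<open>'k\<close>, to be instantiated with \<open>real\<close> and \<open>complex\<close>. A function on the sphere is a
  function that is \<open>undefined\<close> off the sphere (\<open>extensional\<close>), so that equality of such functions is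
  equality on the sphere.
\<close>

section \<open>Continuously differentiable functions\<close>

text \<open>
  \<open>n\<close> times continuous differentiability on an open set \<open>U\<close>: all iterated directional
  derivatives of order at most \<open>n\<close> exist, as total derivatives, and are continuous.
\<close>

primrec Ck_on :: "nat \<Rightarrow> ('a::euclidean_space) set \<Rightarrow> ('a \<Rightarrow> 'k::real_normed_vector) \<Rightarrow> bool" where
  "Ck_on 0 U F \<longleftrightarrow> continuous_on U F"
| "Ck_on (Suc n) U F \<longleftrightarrow> (\<forall>x\<in>U. F differentiable (at x)) \<and>
     (\<forall>v. Ck_on n U (\<lambda>x. frechet_derivative F (at x) v))"

text \<open>
  Differentiability on the sphere is that of an embedded submanifold: locally, the function is
  the restriction of a function of class \<open>C\<^sup>n\<close> on an open subset of the ambient space.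
\<close>

definition C_sphere :: "nat \<Rightarrow> (real ^ 'd \<Rightarrow> 'k::real_normed_vector) set" where
  "C_sphere n = {f \<in> extensional (sphere 0 1).
     \<forall>y\<in>sphere 0 1. \<exists>U F. open U \<and> y \<in> U \<and> Ck_on n U F \<and> (\<forall>x\<in>U \<inter> sphere 0 1. F x = f x)}"

section \<open>Spherical harmonics\<close>

text \<open>A multi-index is a function \<open>'d \<Rightarrow> nat\<close>; there are finitely many of each degree.\<close>

lemma finite_multi_indices: "finite {\<alpha> :: 'd::finite \<Rightarrow> nat. (\<Sum>i\<in>UNIV. \<alpha> i) = l}"
proof (rule finite_subset)
  show "{\<alpha> :: 'd \<Rightarrow> nat. (\<Sum>i\<in>UNIV. \<alpha> i) = l} \<subseteq> UNIV \<rightarrow>\<^sub>E {..l}"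
    by (auto simp: PiE_def intro: member_le_sum)
  show "finite ((UNIV :: 'd set) \<rightarrow>\<^sub>E {..l})"
    by (intro finite_PiE) auto
qed

definition Hom :: "nat \<Rightarrow> (real ^ 'd \<Rightarrow> 'k::real_normed_field) set" where
  "Hom l = {p. \<exists>c :: ('d \<Rightarrow> nat) \<Rightarrow> 'k. p = (\<lambda>x.
     \<Sum>\<alpha> | (\<Sum>i\<in>UNIV. \<alpha> i) = l. c \<alpha> * of_real (\<Prod>i\<in>UNIV. x $ i ^ \<alpha> i))}"

definition partial_deriv :: "'d \<Rightarrow> (real ^ 'd \<Rightarrow> 'k::real_normed_vector) \<Rightarrow> real ^ 'd \<Rightarrow> 'k" where
  "partial_deriv i f x = vector_derivative (\<lambda>t. f (x + t *\<^sub>R axis i 1)) (at 0)"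

definition laplacian :: "(real ^ 'd \<Rightarrow> 'k::real_normed_vector) \<Rightarrow> real ^ 'd \<Rightarrow> 'k" where
  "laplacian f x = (\<Sum>i\<in>UNIV. partial_deriv i (partial_deriv i f) x)"

definition Harm :: "nat \<Rightarrow> (real ^ 'd \<Rightarrow> 'k::real_normed_field) set" where
  "Harm l = {restrict h (sphere 0 1) | h. h \<in> Hom l \<and> (\<forall>x. laplacian h x = 0)}"

text \<open>
  The internal direct sum, as a subspace of the functions on the sphere: the set of all sums of
  one element from each summand (restrictions to the sphere of homogeneous harmonic polynomials of
  different degrees are linearly independent).
\<close>

definition H2 :: "nat \<Rightarrow> (real ^ 'd \<Rightarrow> 'k::real_normed_field) set" where
  "H2 L = {restrict (\<lambda>x. \<Sum>l | l \<le> L \<and> l mod 2 = L mod 2. h l x) (sphere 0 1) | h.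
     \<forall>l. l \<le> L \<and> l mod 2 = L mod 2 \<longrightarrow> h l \<in> Harm l}"

section \<open>Local best approximation\<close>

definition cap :: "real \<Rightarrow> real ^ 'd \<Rightarrow> (real ^ 'd) set" where
  "cap \<delta> y = {z \<in> sphere 0 1. arccos (y \<bullet> z) < \<delta>}"

text \<open>
  The supremum and infimum are taken in the reals. For \<open>f\<close> and all \<open>g \<in> G\<close> continuous on
  the (compact) sphere, \<open>G\<close> nonempty and \<open>\<delta> > 0\<close>, they range over nonempty bounded sets.
\<close>

definition best_approx_error ::
    "real \<Rightarrow> (real ^ 'd \<Rightarrow> 'k::real_normed_field) set \<Rightarrow> (real ^ 'd \<Rightarrow> 'k) \<Rightarrow> real ^ 'd \<Rightarrow> real" where
  "best_approx_error \<delta> G f y = (INF g\<in>G. SUP z\<in>cap \<delta> y. norm (f z - g z))"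

end

theory Submission
  imports Defs
begin

text \<open>
  On the sphere, every homogeneous polynomial of degree \<open>L\<close> is a sum of harmonic ones of degrees
  \<open>L, L - 2, \<dots>\<close>. Hence it suffices to approximate \<open>f\<close> near \<open>y\<close> by homogeneous polynomials of
  degree \<open>L\<close>, and by Taylor's formula \<open>f\<close> may be replaced by a homogeneous polynomial of some degree
  \<open>j\<close> in \<open>h = z - y\<close>. Such a polynomial is negligible if \<open>j > L\<close>. Otherwise use the identity
  \<open>h\<^sub>i = (z\<^sub>i - \<langle>y, z\<rangle> y\<^sub>i) - y\<^sub>i |h|\<^sup>2 / 2\<close> for \<open>|z| = 1\<close>: the first
  term is linear in \<open>z\<close> and vanishes at \<open>y\<close>, so it gains one degree and one order of vanishing at the
  same time, while the second one raises \<open>j\<close>. For \<open>j = 0\<close>, the binomial expansion of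
  \<open>\<langle>y, z\<rangle>\<^sup>L = (1 - |h|\<^sup>2 / 2)\<^sup>L\<close> expresses a constant by \<open>\<langle>y, z\<rangle>\<^sup>L\<close> and positive powers of
  \<open>|h|\<^sup>2\<close>.
\<close>

section \<open>Homogeneous polynomials\<close>

lemma Hom_add: "p \<in> Hom l \<Longrightarrow> q \<in> Hom l \<Longrightarrow> (\<lambda>x. p x + q x) \<in> Hom l"
  unfolding Hom_def
proof safe
  fix c d :: "('a \<Rightarrow> nat) \<Rightarrow> 'b"
  show "\<exists>e. (\<lambda>x. (\<Sum>\<alpha> | sum \<alpha> UNIV = l. c \<alpha> * of_real (\<Prod>i\<in>UNIV. x $ i ^ \<alpha> i)) +
      (\<Sum>\<alpha> | sum \<alpha> UNIV = l. d \<alpha> * of_real (\<Prod>i\<in>UNIV. x $ i ^ \<alpha> i))) =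
      (\<lambda>x. \<Sum>\<alpha> | sum \<alpha> UNIV = l. e \<alpha> * of_real (\<Prod>i\<in>UNIV. x $ i ^ \<alpha> i))"
    by (rule exI[of _ "\<lambda>\<alpha>. c \<alpha> + d \<alpha>"]) (simp add: sum.distrib distrib_right)
qed

lemma Hom_mult_const: "p \<in> Hom l \<Longrightarrow> (\<lambda>x. a * p x) \<in> Hom l"
  unfolding Hom_def
proof safe
  fix c :: "('a \<Rightarrow> nat) \<Rightarrow> 'b"
  show "\<exists>e. (\<lambda>x. a * (\<Sum>\<alpha> | sum \<alpha> UNIV = l. c \<alpha> * of_real (\<Prod>i\<in>UNIV. x $ i ^ \<alpha> i))) =
      (\<lambda>x. \<Sum>\<alpha> | sum \<alpha> UNIV = l. e \<alpha> * of_real (\<Prod>i\<in>UNIV. x $ i ^ \<alpha> i))"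
    by (rule exI[of _ "\<lambda>\<alpha>. a * c \<alpha>"]) (simp add: sum_distrib_left mult.assoc)
qed

lemma Hom_zero: "(\<lambda>x. 0) \<in> Hom l"
  unfolding Hom_def by (intro CollectI exI[of _ "\<lambda>_. 0"]) simp

lemma Hom_diff: "p \<in> Hom l \<Longrightarrow> q \<in> Hom l \<Longrightarrow> (\<lambda>x. p x - q x) \<in> Hom l"
  using Hom_add[of p l "\<lambda>x. - 1 * q x"] Hom_mult_const[of q l "- 1"] by simp

lemma Hom_sum: "(\<And>i. i \<in> I \<Longrightarrow> p i \<in> Hom l) \<Longrightarrow> (\<lambda>x. \<Sum>i\<in>I. p i x) \<in> Hom l"
  by (induction I rule: infinite_finite_induct) (auto simp: Hom_zero intro: Hom_add)

lemma Hom_monomial: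
  fixes \<alpha> :: "'d::finite \<Rightarrow> nat"
  shows "(\<lambda>x. c * of_real (\<Prod>i\<in>UNIV. x $ i ^ \<alpha> i)) \<in> Hom (sum \<alpha> UNIV)"
  unfolding Hom_def
proof (intro CollectI exI ext)
  fix x :: "real ^ 'd"
  show "c * of_real (\<Prod>i\<in>UNIV. x $ i ^ \<alpha> i) = (\<Sum>\<beta> | sum \<beta> UNIV = sum \<alpha> UNIV.
      (if \<beta> = \<alpha> then c else 0) * of_real (\<Prod>i\<in>UNIV. x $ i ^ \<beta> i))"
    by (simp add: if_distrib[of "\<lambda>a. a * _"] finite_multi_indices cong: if_cong)
qed

lemma Hom_const: "(\<lambda>x :: real ^ 'd::finite. c) \<in> Hom 0"
  using Hom_monomial[where \<alpha> = "\<lambda>_ :: 'd. 0"] by simp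

lemma monomial_Suc:
  fixes x :: "real ^ 'd::finite"
  shows "(\<Prod>k\<in>UNIV. x $ k ^ (\<alpha>(i := Suc (\<alpha> i))) k) = x $ i * (\<Prod>k\<in>UNIV. x $ k ^ \<alpha> k)"
proof -
  have "(\<Prod>k\<in>UNIV - {i}. x $ k ^ (\<alpha>(i := Suc (\<alpha> i))) k) = (\<Prod>k\<in>UNIV - {i}. x $ k ^ \<alpha> k)"
    by (rule prod.cong) auto
  then show ?thesis
    by (subst (1 2) prod.remove[of UNIV i]) auto
qed

lemma degree_Suc: "sum (\<alpha>(i := Suc (\<alpha> i))) UNIV = Suc (sum \<alpha> (UNIV :: 'd::finite set))"
proof -
  have "sum (\<alpha>(i := Suc (\<alpha> i))) (UNIV - {i}) = sum \<alpha> (UNIV - {i})"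
    by (rule sum.cong) auto
  then show ?thesis
    by (subst (1 2) sum.remove[of UNIV i]) auto
qed

lemma Hom_coord_mult:
  fixes p :: "real ^ 'd::finite \<Rightarrow> 'k::real_normed_field"
  assumes "p \<in> Hom l"
  shows "(\<lambda>x. of_real (x $ i) * p x) \<in> Hom (Suc l)"
proof -
  obtain c where p: "p = (\<lambda>x. \<Sum>\<alpha> | sum \<alpha> UNIV = l. c \<alpha> * of_real (\<Prod>i\<in>UNIV. x $ i ^ \<alpha> i))"
    using assms unfolding Hom_def by blast
  have "(\<lambda>x. \<Sum>\<alpha> | sum \<alpha> UNIV = l.
      c \<alpha> * of_real (\<Prod>k\<in>UNIV. x $ k ^ (\<alpha>(i := Suc (\<alpha> i))) k)) \<in> Hom (Suc l)"
  proof (rule Hom_sum)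
    fix \<alpha> :: "'d \<Rightarrow> nat" assume "\<alpha> \<in> {\<alpha>. sum \<alpha> UNIV = l}"
    then show "(\<lambda>x. c \<alpha> * of_real (\<Prod>k\<in>UNIV. x $ k ^ (\<alpha>(i := Suc (\<alpha> i))) k)) \<in> Hom (Suc l)"
      using Hom_monomial[of "c \<alpha>" "\<alpha>(i := Suc (\<alpha> i))"] by (simp only: degree_Suc mem_Collect_eq)
  qed
  then show ?thesis
    unfolding p monomial_Suc of_real_mult sum_distrib_left mult.left_commute[of "of_real _"] .
qed

text \<open>Constants, multiplication by a coordinate and addition generate all homogeneous
  polynomials, because a monomial of positive degree has a variable that can be split off. With this
  rule later arguments no longer handle multi-indices.\<close>

lemma Hom_induct [consumes 1, case_names const coord add]:
  fixes p :: "real ^ 'd::finite \<Rightarrow> 'k::real_normed_field"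
  assumes "p \<in> Hom l"
    and const: "\<And>c. P 0 (\<lambda>x. c)"
    and coord: "\<And>l i p. p \<in> Hom l \<Longrightarrow> P l p \<Longrightarrow> P (Suc l) (\<lambda>x. of_real (x $ i) * p x)"
    and add: "\<And>l p q. p \<in> Hom l \<Longrightarrow> q \<in> Hom l \<Longrightarrow> P l p \<Longrightarrow> P l q \<Longrightarrow> P l (\<lambda>x. p x + q x)"
  shows "P l p"
proof -
  obtain c where p: "p = (\<lambda>x. \<Sum>\<alpha> | sum \<alpha> UNIV = l. c \<alpha> * of_real (\<Prod>i\<in>UNIV. x $ i ^ \<alpha> i))"
    using \<open>p \<in> Hom l\<close> unfolding Hom_def by blast
  have monomial: "P l (\<lambda>x. c * of_real (\<Prod>i\<in>UNIV. x $ i ^ \<alpha> i))"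
    if "sum \<alpha> UNIV = l" for l c and \<alpha> :: "'d \<Rightarrow> nat"
    using that
  proof (induction l arbitrary: \<alpha>)
    case 0
    then show ?case using const by simp
  next
    case (Suc l)
    then obtain i where i: "\<alpha> i > 0"
      by (metis gr0I sum.neutral nat.simps(3))
    define \<beta> where "\<beta> = \<alpha>(i := \<alpha> i - 1)"
    have \<alpha>: "\<alpha> = \<beta>(i := Suc (\<beta> i))"
      using i by (auto simp: \<beta>_def)
    have "sum \<beta> UNIV = l"
      using Suc.prems degree_Suc[of \<beta> i] \<alpha> by simp
    then have "P (Suc l) (\<lambda>x. of_real (x $ i) * (c * of_real (\<Prod>i\<in>UNIV. x $ i ^ \<beta> i)))"
      using coord[OF _ Suc.IH] Hom_monomial by blast
    then show ?case
      by (subst \<alpha>, unfold monomial_Suc) (simp add: algebra_simps)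
  qed
  \<comment> \<open>The empty sum needs the zero polynomial in every degree \<open>l\<close>; it is
    the constant 0 multiplied \<open>l\<close> times by a coordinate.\<close>
  have zero: "P l (\<lambda>x. 0)"
  proof (induction l)
    case (Suc l)
    then show ?case using coord[OF Hom_zero Suc] by simp
  qed (rule const)
  have "P l (\<lambda>x. \<Sum>\<alpha>\<in>A. c \<alpha> * of_real (\<Prod>i\<in>UNIV. x $ i ^ \<alpha> i))"
    if "finite A" "A \<subseteq> {\<alpha>. sum \<alpha> UNIV = l}" for A
    using that
  proof (induction A)
    case empty
    then show ?case using zero by simp
  next
    case (insert \<alpha> A)
    have "P l (\<lambda>x. c \<alpha> * of_real (\<Prod>i\<in>UNIV. x $ i ^ \<alpha> i) +
        (\<Sum>\<alpha>\<in>A. c \<alpha> * of_real (\<Prod>i\<in>UNIV. x $ i ^ \<alpha> i)))"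
    proof (rule add)
      show "(\<lambda>x. c \<alpha> * of_real (\<Prod>i\<in>UNIV. x $ i ^ \<alpha> i)) \<in> Hom l"
        using Hom_monomial[of "c \<alpha>" \<alpha>] insert.prems by simp
      show "(\<lambda>x. \<Sum>\<alpha>\<in>A. c \<alpha> * of_real (\<Prod>i\<in>UNIV. x $ i ^ \<alpha> i)) \<in> Hom l"
      proof (rule Hom_sum)
        fix \<beta> assume "\<beta> \<in> A"
        then show "(\<lambda>x. c \<beta> * of_real (\<Prod>i\<in>UNIV. x $ i ^ \<beta> i)) \<in> Hom l"
          using Hom_monomial[of "c \<beta>" \<beta>] insert.prems by auto
      qed
    qed (use insert monomial in auto)
    with insert.hyps show ?case by simp
  qed
  then show ?thesis
    unfolding p using finite_multi_indices by blast
qed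

lemma Hom_inner_mult:
  assumes "p \<in> Hom l"
  shows "(\<lambda>x. of_real (v \<bullet> x) * p x) \<in> Hom (Suc l)"
proof -
  have "(\<lambda>x. \<Sum>i\<in>UNIV. of_real (v $ i) * (of_real (x $ i) * p x)) \<in> Hom (Suc l)"
    by (intro Hom_sum Hom_mult_const Hom_coord_mult assms)
  then show ?thesis
    by (simp add: inner_vec_def sum_distrib_right mult.assoc)
qed

lemma Hom_norm_sq_mult:
  assumes "p \<in> Hom l"
  shows "(\<lambda>x. of_real ((norm x)\<^sup>2) * p x) \<in> Hom (Suc (Suc l))"
proof -
  have "(\<lambda>x. \<Sum>i\<in>UNIV. of_real (x $ i) * (of_real (x $ i) * p x)) \<in> Hom (Suc (Suc l))"
    by (rule Hom_sum) (rule Hom_coord_mult[OF Hom_coord_mult[OF assms]])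
  then show ?thesis
    unfolding power2_norm_eq_inner inner_vec_def
    by (simp add: sum_distrib_right mult.assoc del: dot_square_norm)
qed

section \<open>Scaling, growth and differentiability of homogeneous polynomials\<close>

lemma Hom_scaleR: "p \<in> Hom l \<Longrightarrow> p (s *\<^sub>R x) = of_real s ^ l * p x"
  by (induction rule: Hom_induct) (auto simp: algebra_simps)

lemma continuous_on_Hom: "p \<in> Hom l \<Longrightarrow> continuous_on S p"
  by (induction rule: Hom_induct) (auto intro!: continuous_intros)

lemma Hom_norm_le:
  assumes "p \<in> Hom l"
  shows "\<exists>C. \<forall>x. norm (p x) \<le> C * norm x ^ l"
  using assms
proof (induction rule: Hom_induct)
  case (coord l i p)
  then obtain C where "\<And>x. norm (p x) \<le> C * norm x ^ l" by blast
  then have "\<bar>x $ i\<bar> * norm (p x) \<le> norm x * (C * norm x ^ l)" for x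
    by (intro mult_mono component_le_norm_cart) auto
  then show ?case by (auto simp: norm_mult algebra_simps intro!: exI[of _ C])
next
  case (add l p q)
  then obtain C D where "\<And>x. norm (p x) \<le> C * norm x ^ l" "\<And>x. norm (q x) \<le> D * norm x ^ l"
    by blast
  then have "norm (p x + q x) \<le> (C + D) * norm x ^ l" for x
    by (metis norm_triangle_mono distrib_right)
  then show ?case by blast
qed auto

text \<open>Since \<open>l - 1\<close> is truncated, membership in \<open>Hom (l - 1)\<close> says
  too little for \<open>l = 0\<close>. The separate clause makes the derivative zero there, which
  the product rule in the induction uses to keep the degree right.\<close>

lemma Hom_has_partial_deriv:
  assumes "p \<in> Hom l"
  shows "\<exists>q \<in> Hom (l - 1). (l = 0 \<longrightarrow> q = (\<lambda>x. 0)) \<and>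
    (\<forall>x. ((\<lambda>t. p (x + t *\<^sub>R axis i 1)) has_vector_derivative q x) (at 0))"
  using assms
proof (induction rule: Hom_induct)
  case (const c)
  show ?case by (rule bexI[OF _ Hom_zero]) simp
next
  case (coord l j p)
  then obtain q where q: "q \<in> Hom (l - 1)" "l = 0 \<longrightarrow> q = (\<lambda>x. 0)"
    "\<And>x. ((\<lambda>t. p (x + t *\<^sub>R axis i 1)) has_vector_derivative q x) (at 0)" by blast
  have "(\<lambda>x. of_real (x $ j) * q x) \<in> Hom l"
    using q Hom_coord_mult[OF q(1)] Hom_zero by (cases l) auto
  then have Hom: "(\<lambda>x. of_real (axis i 1 $ j) * p x + of_real (x $ j) * q x) \<in> Hom (Suc l - 1)"
    using Hom_add[OF Hom_mult_const[OF coord(1)]] by simp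
  have "((\<lambda>t. of_real ((x + t *\<^sub>R axis i 1) $ j) * p (x + t *\<^sub>R axis i 1)) has_vector_derivative
      of_real (axis i 1 $ j) * p x + of_real (x $ j) * q x) (at 0)" for x
  proof -
    have "((\<lambda>t. (x + t *\<^sub>R axis i 1) $ j) has_real_derivative axis i 1 $ j) (at 0)"
      by (auto intro!: derivative_eq_intros)
    then have "((\<lambda>t. of_real ((x + t *\<^sub>R axis i 1) $ j) :: 'b) has_vector_derivative
        of_real (axis i 1 $ j)) (at 0)"
      by (rule has_vector_derivative_of_real)
    from has_vector_derivative_mult[OF this q(3)[of x]] show ?thesis
      by (simp add: add.commute)
  qed
  with Hom show ?case by (intro bexI[OF _ Hom]) auto
next
  case (add l p q)
  then obtain p' q' where "p' \<in> Hom (l - 1)" "l = 0 \<longrightarrow> p' = (\<lambda>x. 0)"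
    "\<And>x. ((\<lambda>t. p (x + t *\<^sub>R axis i 1)) has_vector_derivative p' x) (at 0)"
    "q' \<in> Hom (l - 1)" "l = 0 \<longrightarrow> q' = (\<lambda>x. 0)"
    "\<And>x. ((\<lambda>t. q (x + t *\<^sub>R axis i 1)) has_vector_derivative q' x) (at 0)" by blast
  then show ?case
    by (intro bexI[OF _ Hom_add[of p' _ q']]) (auto intro: has_vector_derivative_add)
qed

section \<open>Harmonic decomposition\<close>

lemma partial_deriv_eqI:
  "(\<And>x. ((\<lambda>t. p (x + t *\<^sub>R axis i 1)) has_vector_derivative q x) (at 0)) \<Longrightarrow> partial_deriv i p = q"
  unfolding partial_deriv_def by (rule ext) (rule vector_derivative_at)

lemma has_partial_deriv_Hom:
  assumes "p \<in> Hom l"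
  shows "((\<lambda>t. p (x + t *\<^sub>R axis i 1)) has_vector_derivative partial_deriv i p x) (at 0)"
proof -
  obtain q where q: "\<forall>x. ((\<lambda>t. p (x + t *\<^sub>R axis i 1)) has_vector_derivative q x) (at 0)"
    using Hom_has_partial_deriv[OF assms, of i] by (elim bexE conjE) (rule that)
  show ?thesis
    unfolding partial_deriv_eqI[OF q[rule_format]] by (rule q[rule_format])
qed

lemma partial_deriv_Hom:
  assumes "p \<in> Hom l"
  shows "partial_deriv i p \<in> Hom (l - 1)" and "l = 0 \<Longrightarrow> partial_deriv i p = (\<lambda>x. 0)"
proof -
  obtain q where "q \<in> Hom (l - 1)" "l = 0 \<longrightarrow> q = (\<lambda>x. 0)"
    "\<And>x. ((\<lambda>t. p (x + t *\<^sub>R axis i 1)) has_vector_derivative q x) (at 0)"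
    using Hom_has_partial_deriv[OF assms, of i] by auto
  moreover from this(3) have "partial_deriv i p = q"
    by (rule partial_deriv_eqI)
  ultimately show "partial_deriv i p \<in> Hom (l - 1)" "l = 0 \<Longrightarrow> partial_deriv i p = (\<lambda>x. 0)"
    by simp_all
qed

lemma partial_deriv_add:
  assumes "p \<in> Hom l" "q \<in> Hom m"
  shows "partial_deriv i (\<lambda>x. p x + q x) = (\<lambda>x. partial_deriv i p x + partial_deriv i q x)"
  by (rule partial_deriv_eqI)
    (rule has_vector_derivative_add[OF has_partial_deriv_Hom[OF assms(1)] has_partial_deriv_Hom[OF assms(2)]])

lemma partial_deriv_mult_const:
  assumes "p \<in> Hom l"
  shows "partial_deriv i (\<lambda>x. a * p x) = (\<lambda>x. a * partial_deriv i p x)"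
  by (rule partial_deriv_eqI)
    (rule has_vector_derivative_mult_right[OF has_partial_deriv_Hom[OF assms]])

lemma partial_deriv_of_real_mult:
  assumes "p \<in> Hom l"
    and "\<And>x. ((\<lambda>t. r (x + t *\<^sub>R axis i 1)) has_real_derivative r' x) (at 0)"
  shows "partial_deriv i (\<lambda>x. of_real (r x) * p x) =
    (\<lambda>x. of_real (r x) * partial_deriv i p x + of_real (r' x) * p x)"
proof (rule partial_deriv_eqI)
  fix x
  show "((\<lambda>t. of_real (r (x + t *\<^sub>R axis i 1)) * p (x + t *\<^sub>R axis i 1)) has_vector_derivative
      of_real (r x) * partial_deriv i p x + of_real (r' x) * p x) (at 0)"
    using has_vector_derivative_mult[OF has_vector_derivative_of_real[OF assms(2)[of x]]
      has_partial_deriv_Hom[OF assms(1)]] by simp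
qed

lemma partial_deriv_coord_mult:
  assumes "p \<in> Hom l"
  shows "partial_deriv i (\<lambda>x. of_real (x $ j) * p x) =
    (\<lambda>x. of_real (x $ j) * partial_deriv i p x + of_real (axis i 1 $ j) * p x)"
  by (rule partial_deriv_of_real_mult[OF assms]) (auto intro!: derivative_eq_intros)

lemma partial_deriv_norm_sq_mult:
  assumes "p \<in> Hom l"
  shows "partial_deriv i (\<lambda>x. of_real ((norm x)\<^sup>2) * p x) =
    (\<lambda>x. of_real ((norm x)\<^sup>2) * partial_deriv i p x + of_real (2 * x $ i) * p x)"
proof (rule partial_deriv_of_real_mult[OF assms])
  fix x :: "real ^ 'a"
  have "(norm (x + t *\<^sub>R axis i 1))\<^sup>2 = (norm x)\<^sup>2 + 2 * x $ i * t + t\<^sup>2" for t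
    unfolding power2_norm_eq_inner
    by (simp add: inner_add_left inner_add_right inner_axis inner_axis' power2_eq_square
        algebra_simps)
  then show "((\<lambda>t. (norm (x + t *\<^sub>R axis i 1))\<^sup>2) has_real_derivative 2 * x $ i) (at 0)"
    by (auto intro!: derivative_eq_intros)
qed

section \<open>Euler's identity and the Laplacian\<close>

lemma Euler_identity:
  assumes "p \<in> Hom l"
  shows "(\<Sum>i\<in>UNIV. of_real (x $ i) * partial_deriv i p x) = of_nat l * p x"
  using assms
proof (induction rule: Hom_induct)
  case (const c)
  then show ?case
    by (simp add: partial_deriv_Hom(2)[OF Hom_const])
next
  case (coord l j p)
  \<comment> \<open>Differentiating the factor \<open>x $ j\<close> contributes only for
    \<open>i = j\<close>, namely one more copy of the product; this raises the Euler factor from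
    \<open>l\<close> to \<open>Suc l\<close>.\<close>
  have "(\<Sum>i\<in>UNIV. of_real (x $ i) * (of_real (x $ j) * partial_deriv i p x +
      of_real (axis i 1 $ j) * p x)) =
    of_real (x $ j) * (\<Sum>i\<in>UNIV. of_real (x $ i) * partial_deriv i p x) +
    (\<Sum>i\<in>UNIV. if i = j then of_real (x $ j) * p x else 0)"
    unfolding sum_distrib_left sum.distrib[symmetric]
    by (rule sum.cong) (auto simp: axis_def algebra_simps)
  then show ?case
    unfolding partial_deriv_coord_mult[OF coord(1)] coord(2) by (simp add: algebra_simps)
next
  case (add l p q)
  then show ?case
    by (simp add: partial_deriv_add[OF add(1,2)] distrib_left sum.distrib)
qed

lemma laplacian_Hom:
  assumes "p \<in> Hom l"
  shows "laplacian p \<in> Hom (l - 2)" and "l < 2 \<Longrightarrow> laplacian p = (\<lambda>x. 0)"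
proof -
  have "(\<lambda>x. \<Sum>i\<in>UNIV. partial_deriv i (partial_deriv i p) x) \<in> Hom (l - 2)"
  proof (rule Hom_sum)
    fix i
    show "partial_deriv i (partial_deriv i p) \<in> Hom (l - 2)"
      using partial_deriv_Hom(1)[OF partial_deriv_Hom(1)[OF assms], of i i]
      by (simp add: numeral_2_eq_2)
  qed
  then show "laplacian p \<in> Hom (l - 2)"
    by (simp add: laplacian_def[abs_def])
  show "laplacian p = (\<lambda>x. 0)" if "l < 2"
    using that partial_deriv_Hom(2)[OF partial_deriv_Hom(1)[OF assms]]
    by (auto simp: laplacian_def)
qed

lemma laplacian_add:
  assumes "p \<in> Hom l" "q \<in> Hom m"
  shows "laplacian (\<lambda>x. p x + q x) x = laplacian p x + laplacian q x"
  unfolding laplacian_def partial_deriv_add[OF assms]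
    partial_deriv_add[OF partial_deriv_Hom(1)[OF assms(1)] partial_deriv_Hom(1)[OF assms(2)]]
  by (rule sum.distrib)

lemma laplacian_mult_const:
  assumes "p \<in> Hom l"
  shows "laplacian (\<lambda>x. a * p x) x = a * laplacian p x"
  unfolding laplacian_def partial_deriv_mult_const[OF assms]
    partial_deriv_mult_const[OF partial_deriv_Hom(1)[OF assms]]
  by (rule sum_distrib_left[symmetric])

lemma laplacian_diff:
  assumes "p \<in> Hom l" "q \<in> Hom m"
  shows "laplacian (\<lambda>x. p x - q x) x = laplacian p x - laplacian q x"
  using laplacian_add[OF assms(1) Hom_mult_const[OF assms(2)], of "- 1" x]
    laplacian_mult_const[OF assms(2), of "- 1" x] by simp

text \<open>With r = |x|, the product rule gives p times the Laplacian of r^2, plus 2 grad(r^2) .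
  grad p, plus r^2 times the Laplacian of p. The Laplacian of r^2 is 2d, and grad(r^2) = 2x turns
  the middle term into 4 l p by Euler's identity.\<close>

lemma laplacian_norm_sq_mult:
  fixes p :: "real ^ 'd::finite \<Rightarrow> 'k::real_normed_field"
  assumes p: "p \<in> Hom l"
  shows "laplacian (\<lambda>x. of_real ((norm x)\<^sup>2) * p x) x =
    of_real (2 * real CARD('d) + 4 * real l) * p x + of_real ((norm x)\<^sup>2) * laplacian p x"
proof -
  note p' = partial_deriv_Hom(1)[OF p]
  have "partial_deriv i (\<lambda>x. of_real ((norm x)\<^sup>2) * partial_deriv i p x + of_real (2 * x $ i) * p x) x
      = of_real ((norm x)\<^sup>2) * partial_deriv i (partial_deriv i p) x
        + 4 * (of_real (x $ i) * partial_deriv i p x) + 2 * p x" for i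
  proof -
    have "partial_deriv i (\<lambda>x. of_real (2 * x $ i) * p x) =
        (\<lambda>x. of_real (2 * x $ i) * partial_deriv i p x + of_real 2 * p x)"
      by (rule partial_deriv_of_real_mult[OF p]) (auto intro!: derivative_eq_intros)
    moreover have "(\<lambda>x. of_real (2 * x $ i) * p x) \<in> Hom (Suc l)"
      using Hom_mult_const[OF Hom_coord_mult[OF p], of 2 i] by (simp add: mult.assoc)
    ultimately show ?thesis
      using partial_deriv_add[OF Hom_norm_sq_mult[OF p']] partial_deriv_norm_sq_mult[OF p']
      by (simp add: algebra_simps)
  qed
  then have "laplacian (\<lambda>x. of_real ((norm x)\<^sup>2) * p x) x =
      of_real ((norm x)\<^sup>2) * laplacian p x
        + 4 * (\<Sum>i\<in>UNIV. of_real (x $ i) * partial_deriv i p x) + of_nat CARD('d) * (2 * p x)"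
    unfolding laplacian_def partial_deriv_norm_sq_mult[OF p]
    by (simp add: sum.distrib sum_distrib_left)
  then show ?thesis
    unfolding Euler_identity[OF p] by (simp add: algebra_simps)
qed

text \<open>
  With \<open>p = (g - r\<^sup>2 u) / c\<close> and \<open>r = |x|\<close>, the equation \<open>c p + r\<^sup>2 \<Delta>p = g\<close> becomes an equation of the same
  form for \<open>u\<close>, of degree smaller by two and with a larger constant.
\<close>

lemma laplacian_perturbation_surj:
  fixes g :: "real ^ 'd::finite \<Rightarrow> 'k::real_normed_field"
  assumes "g \<in> Hom l" "c > 0"
  shows "\<exists>p \<in> Hom l. \<forall>x. of_real c * p x + of_real ((norm x)\<^sup>2) * laplacian p x = g x"
  using assms
proof (induction l arbitrary: c g rule: less_induct)
  case (less l)
  show ?case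
  proof (cases "l < 2")
    case True
    have p: "(\<lambda>x. of_real (1 / c) * g x) \<in> Hom l"
      by (rule Hom_mult_const[OF less.prems(1)])
    show ?thesis
      by (rule bexI[OF _ p]) (use less.prems(2) laplacian_Hom(2)[OF p True] in simp)
  next
    case False
    define m where "m = l - 2"
    have l: "l = Suc (Suc m)"
      using False by (simp add: m_def)
    \<comment> \<open>The constant \<open>b\<close> is the factor produced by the Laplacian of |x|^2
      u for \<open>u\<close> of degree \<open>m\<close>. Applying the Laplacian to c p = g - |x|^2 u
      and asking for \<open>laplacian p = u\<close> gives the equation for \<open>u\<close> below,
      with \<open>c + b\<close> in place of \<open>c\<close>.\<close>
    define b where "b = 2 * real CARD('d) + 4 * real m"
    have "b \<ge> 0" by (simp add: b_def)
    have "laplacian g \<in> Hom m"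
      using laplacian_Hom(1)[OF less.prems(1)] by (simp add: l)
    then obtain u where u: "u \<in> Hom m"
      "\<And>x. of_real (c + b) * u x + of_real ((norm x)\<^sup>2) * laplacian u x = laplacian g x"
      using less.IH[of m "laplacian g" "c + b"] \<open>b \<ge> 0\<close> \<open>c > 0\<close> by (auto simp: l)
    define p where "p = (\<lambda>x. of_real (1 / c) * (g x - of_real ((norm x)\<^sup>2) * u x))"
    have ru: "(\<lambda>x. of_real ((norm x)\<^sup>2) * u x) \<in> Hom l"
      unfolding l by (rule Hom_norm_sq_mult[OF u(1)])
    have p: "p \<in> Hom l"
      unfolding p_def by (rule Hom_mult_const[OF Hom_diff[OF less.prems(1) ru]])
    have "laplacian p x = u x" for x
    proof -
      have "laplacian p x = of_real (1 / c) * (laplacian g x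
          - (of_real b * u x + of_real ((norm x)\<^sup>2) * laplacian u x))"
        unfolding p_def laplacian_mult_const[OF Hom_diff[OF less.prems(1) ru]]
          laplacian_diff[OF less.prems(1) ru] laplacian_norm_sq_mult[OF u(1)] b_def ..
      also have "\<dots> = u x"
        unfolding u(2)[symmetric] using \<open>c > 0\<close> by (simp add: field_simps)
      finally show ?thesis .
    qed
    then have "of_real c * p x + of_real ((norm x)\<^sup>2) * laplacian p x = g x" for x
      using \<open>c > 0\<close> by (simp add: p_def)
    with p show ?thesis by blast
  qed
qed

text \<open>The difference q - |x|^2 p is harmonic exactly if |x|^2 p and q have the same Laplacian.
  By \<open>laplacian_norm_sq_mult\<close> this is the equation of
  \<open>laplacian_perturbation_surj\<close> with the positive constant 2d + 4m.\<close>

lemma Hom_decomposition: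
  fixes q :: "real ^ 'd::finite \<Rightarrow> 'k::real_normed_field"
  assumes q: "q \<in> Hom (Suc (Suc m))"
  obtains h p where "h \<in> Hom (Suc (Suc m))" "\<And>x. laplacian h x = 0" "p \<in> Hom m"
    "\<And>x. q x = h x + of_real ((norm x)\<^sup>2) * p x"
proof -
  have "laplacian q \<in> Hom m"
    using laplacian_Hom(1)[OF q] by simp
  then obtain p where p: "p \<in> Hom m" "\<And>x. of_real (2 * real CARD('d) + 4 * real m) * p x +
      of_real ((norm x)\<^sup>2) * laplacian p x = laplacian q x"
    using laplacian_perturbation_surj[of "laplacian q" m "2 * real CARD('d) + 4 * real m"]
    by (auto simp: add_pos_nonneg)
  note rp = Hom_norm_sq_mult[OF p(1)]
  show ?thesis
  proof
    show "(\<lambda>x. q x - of_real ((norm x)\<^sup>2) * p x) \<in> Hom (Suc (Suc m))"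
      by (rule Hom_diff[OF q rp])
    show "laplacian (\<lambda>x. q x - of_real ((norm x)\<^sup>2) * p x) x = 0" for x
      unfolding laplacian_diff[OF q rp] laplacian_norm_sq_mult[OF p(1)] p(2) by simp
  qed (use p in auto)
qed

text \<open>On the sphere the factor |x|^2 in \<open>Hom_decomposition\<close> is 1, so the second
  term is a homogeneous polynomial of degree \<open>L - 2\<close>, to which the argument applies
  again. The parity is preserved, and in degrees 0 and 1 every polynomial is harmonic.\<close>

lemma restrict_Hom_in_H2:
  fixes q :: "real ^ 'd::finite \<Rightarrow> 'k::real_normed_field"
  assumes "q \<in> Hom L"
  shows "restrict q (sphere 0 1) \<in> H2 L"
  using assms
proof (induction L arbitrary: q rule: less_induct)
  case (less L)
  show ?case
  proof (cases "L < 2")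
    case True
    then have index: "{l. l \<le> L \<and> l mod 2 = L mod 2} = {L}"
      by (auto simp: less_2_cases_iff le_Suc_eq)
    have "restrict q (sphere 0 1) \<in> Harm L"
      using less.prems laplacian_Hom(2)[OF less.prems True] unfolding Harm_def by auto
    moreover have "l = L" if "l \<le> L" "l mod 2 = L mod 2" for l
      using index that by blast
    ultimately show ?thesis
      unfolding H2_def index
      by (intro CollectI exI[of _ "\<lambda>l. restrict q (sphere 0 1)"]) auto
  next
    case False
    define m where "m = L - 2"
    have L: "L = Suc (Suc m)"
      using False by (simp add: m_def)
    obtain h p where h: "h \<in> Hom L" "\<And>x. laplacian h x = 0" and p: "p \<in> Hom m"
      and q: "\<And>x. q x = h x + of_real ((norm x)\<^sup>2) * p x"
      using Hom_decomposition less.prems unfolding L by metis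
    have "restrict p (sphere 0 1) \<in> H2 m"
      by (rule less.IH[OF _ p]) (simp add: L)
    then obtain k where k: "\<And>l. l \<le> m \<Longrightarrow> l mod 2 = m mod 2 \<Longrightarrow> k l \<in> Harm l"
      "restrict p (sphere 0 1) = restrict (\<lambda>x. \<Sum>l | l \<le> m \<and> l mod 2 = m mod 2. k l x) (sphere 0 1)"
      unfolding H2_def by auto
    have index: "{l. l \<le> L \<and> l mod 2 = L mod 2} = insert L {l. l \<le> m \<and> l mod 2 = m mod 2}"
      unfolding L by (auto simp: le_Suc_eq mod_Suc)
    have "restrict h (sphere 0 1) \<in> Harm L"
      using h unfolding Harm_def by auto
    then have "(k(L := restrict h (sphere 0 1))) l \<in> Harm l" if "l \<le> L" "l mod 2 = L mod 2" for l
      using k(1) that index by auto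
    moreover have "restrict q (sphere 0 1) x = restrict (\<lambda>x. \<Sum>l | l \<le> L \<and> l mod 2 = L mod 2.
        (k(L := restrict h (sphere 0 1))) l x) (sphere 0 1) x" for x
    proof (cases "x \<in> sphere 0 1")
      case True
      \<comment> \<open>The index \<open>L\<close> exceeds \<open>m\<close>, so storing the new
        summand at \<open>L\<close> leaves the lower ones intact.\<close>
      have "(\<Sum>l | l \<le> m \<and> l mod 2 = m mod 2. (k(L := restrict h (sphere 0 1))) l x) =
          (\<Sum>l | l \<le> m \<and> l mod 2 = m mod 2. k l x)"
        by (rule sum.cong) (auto simp: L)
      moreover have "p x = (\<Sum>l | l \<le> m \<and> l mod 2 = m mod 2. k l x)"
        using fun_cong[OF k(2), of x] True by simp
      ultimately show ?thesis
        using True unfolding index by (simp add: q L)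
    qed simp
    ultimately show ?thesis
      unfolding H2_def by blast
  qed
qed

section \<open>Taylor approximation\<close>

lemma frechet_derivative_axis_sum:
  fixes F :: "real ^ 'd::finite \<Rightarrow> 'k::real_normed_vector"
  assumes "F differentiable (at x)"
  shows "frechet_derivative F (at x) h = (\<Sum>i\<in>UNIV. (h $ i) *\<^sub>R frechet_derivative F (at x) (axis i 1))"
proof -
  have lin: "linear (frechet_derivative F (at x))"
    using assms by (rule linear_frechet_derivative)
  have "h = (\<Sum>i\<in>UNIV. (h $ i) *\<^sub>R axis i 1)"
    using basis_expansion[of h] by (simp add: scalar_mult_eq_scaleR)
  then have "frechet_derivative F (at x) h = frechet_derivative F (at x) (\<Sum>i\<in>UNIV. (h $ i) *\<^sub>R axis i 1)"
    by simp
  then show ?thesis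
    by (simp add: linear_sum[OF lin] linear_cmul[OF lin])
qed

text \<open>The induction applies its hypothesis to the partial derivatives and integrates along the
  segment from \<open>y\<close> to \<open>y + h\<close>, in the form of the mean value inequality.
  The \<open>P j\<close> are only asserted to exist, so they can be built by this integration
  instead of from higher derivatives.\<close>

lemma Taylor_Hom:
  fixes F :: "real ^ 'd::finite \<Rightarrow> 'k::real_normed_field"
  assumes "Ck_on n U F" "open U" "y \<in> U"
  shows "\<exists>P C r. r > 0 \<and> (\<forall>j<n. P j \<in> Hom j) \<and>
    (\<forall>h. norm h < r \<longrightarrow> norm (F (y + h) - (\<Sum>j<n. P j h)) \<le> C * norm h ^ n)"
  using assms(1)
proof (induction n arbitrary: F)
  case 0
  \<comment> \<open>For \<open>n = 0\<close> the claim is that \<open>F\<close> is bounded near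
    \<open>y\<close>, since \<open>norm h ^ 0 = 1\<close>.\<close>
  then have "isCont F y"
    using assms(2,3) by (simp add: continuous_on_eq_continuous_at)
  then obtain r where r: "r > 0" "\<And>x. dist x y < r \<Longrightarrow> dist (F x) (F y) < 1"
    unfolding continuous_at_eps_delta by (metis zero_less_one)
  have "norm (F (y + h)) \<le> norm (F y) + 1" if "norm h < r" for h
    using r(2)[of "y + h"] that norm_triangle_ineq2[of "F (y + h)" "F y"] by (simp add: dist_norm)
  with r(1) show ?case
    by (intro exI[of _ "\<lambda>_ _. 0"] exI[of _ "norm (F y) + 1"] exI[of _ r]) auto
next
  case (Suc n)
  define D where "D i x = frechet_derivative F (at x) (axis i 1)" for i x
  have diff: "F differentiable (at x)" if "x \<in> U" for x
    using Suc.prems that by simp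
  have "Ck_on n U (D i)" for i
    using Suc.prems by (simp add: D_def[abs_def])
  then have "\<forall>i. \<exists>P C r. r > 0 \<and> (\<forall>j<n. P j \<in> Hom j) \<and>
      (\<forall>h. norm h < r \<longrightarrow> norm (D i (y + h) - (\<Sum>j<n. P j h)) \<le> C * norm h ^ n)"
    using Suc.IH by blast
  then obtain P C r where r: "\<And>i. r i > 0" and P: "\<And>i j. j < n \<Longrightarrow> P i j \<in> Hom j"
    and bound: "\<And>i h. norm h < r i \<Longrightarrow> norm (D i (y + h) - (\<Sum>j<n. P i j h)) \<le> C i * norm h ^ n"
    unfolding choice_iff by blast
  obtain r0 where r0: "r0 > 0" "ball y r0 \<subseteq> U"
    using assms(2,3) open_contains_ball by blast
  define R where "R = Min (insert r0 (range r))"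
  have R: "R > 0" "R \<le> r0" "\<And>i. R \<le> r i"
    unfolding R_def using r r0 by (auto intro: min.coboundedI2)
  \<comment> \<open>\<open>A j\<close> contracts the degree \<open>j\<close> parts of the partial
    derivatives with \<open>h\<close>. Along the segment it appears with the factor s^j, whose
    integral over [0, 1] is the factor 1 / (j + 1) in \<open>Q\<close>.\<close>
  define A where "A j h = (\<Sum>i\<in>UNIV. of_real (h $ i) * P i j h)" for j h
  have A: "A j \<in> Hom (Suc j)" if "j < n" for j
    unfolding A_def[abs_def] by (rule Hom_sum) (rule Hom_coord_mult[OF P[OF that]])
  define Q where "Q j h = (case j of 0 \<Rightarrow> F y | Suc j \<Rightarrow> of_real (1 / real (Suc j)) * A j h)" for j h
  have Q: "Q j \<in> Hom j" if "j < Suc n" for j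
  proof (cases j)
    case 0
    then show ?thesis by (simp add: Q_def[abs_def] Hom_const)
  next
    case (Suc k)
    then have "(\<lambda>h. of_real (1 / real (Suc k)) * A k h) \<in> Hom (Suc k)"
      using that by (intro Hom_mult_const A) simp
    then show ?thesis by (simp add: Q_def[abs_def] Suc)
  qed
  have "norm (F (y + h) - (\<Sum>j<Suc n. Q j h)) \<le> (\<Sum>i\<in>UNIV. \<bar>C i\<bar>) * norm h ^ Suc n"
    if h: "norm h < R" for h
  proof -
    \<comment> \<open>\<open>\<phi>\<close> is the remainder along the segment before the constant
      term is subtracted. As \<open>\<phi> 0 = F y\<close>, the wanted error is
      \<open>\<phi> 1 - \<phi> 0\<close>.\<close>
    define \<phi> where "\<phi> s = F (y + s *\<^sub>R h) - (\<Sum>j<n. of_real (s ^ Suc j / real (Suc j)) * A j h)" for s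
    define \<phi>' where "\<phi>' s = frechet_derivative F (at (y + s *\<^sub>R h)) h - (\<Sum>j<n. of_real (s ^ j) * A j h)" for s
    let ?B = "(\<Sum>i\<in>UNIV. \<bar>C i\<bar>) * norm h ^ Suc n"
    have sh: "norm (s *\<^sub>R h) \<le> norm h" if "s \<in> {0..1}" for s
      using that by (simp add: mult_left_le_one_le)
    have inU: "y + s *\<^sub>R h \<in> U" if "s \<in> {0..1}" for s
      using sh[OF that] h R r0 by (auto simp: dist_norm subset_iff)
    have der: "(\<phi> has_derivative (\<lambda>t. t *\<^sub>R \<phi>' s)) (at s within {0..1})" if s: "s \<in> {0..1}" for s
    proof -
      let ?F' = "frechet_derivative F (at (y + s *\<^sub>R h))"
      have F': "(F has_derivative ?F') (at (y + s *\<^sub>R h))"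
        using diff[OF inU[OF s]] by (simp add: frechet_derivative_works)
      have "((\<lambda>s. y + s *\<^sub>R h) has_derivative (\<lambda>t. t *\<^sub>R h)) (at s within {0..1})"
        by (auto intro!: derivative_eq_intros)
      from has_derivative_compose[OF this F']
      have "((\<lambda>s. F (y + s *\<^sub>R h)) has_vector_derivative ?F' h) (at s within {0..1})"
        by (simp add: has_vector_derivative_def linear_cmul[OF has_derivative_linear[OF F']])
      moreover have "((\<lambda>s. \<Sum>j<n. of_real (s ^ Suc j / real (Suc j)) * A j h) has_vector_derivative
          (\<Sum>j<n. of_real (s ^ j) * A j h)) (at s within {0..1})"
      proof (intro has_vector_derivative_sum has_vector_derivative_mult_left has_vector_derivative_of_real)
        fix j
        show "((\<lambda>s. s ^ Suc j / real (Suc j)) has_real_derivative s ^ j) (at s within {0..1})"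
          by (rule derivative_eq_intros refl | simp)+
      qed
      ultimately have "(\<phi> has_vector_derivative \<phi>' s) (at s within {0..1})"
        unfolding \<phi>_def[abs_def] \<phi>'_def by (rule has_vector_derivative_diff)
      then show ?thesis by (simp add: has_vector_derivative_def)
    qed
    have "norm (\<phi>' s) \<le> ?B" if s: "s \<in> {0..1}" for s
    proof -
      \<comment> \<open>Homogeneity moves the power \<open>s ^ j\<close> into the argument of
        \<open>P i j\<close>. Then \<open>\<phi>' s\<close> is a combination of the Taylor errors of
        the \<open>D i\<close> at \<open>s *\<^sub>R h\<close>, which the induction hypothesis
        bounds.\<close>
      have "of_real (s ^ j) * A j h = (\<Sum>i\<in>UNIV. of_real (h $ i) * P i j (s *\<^sub>R h))" if "j < n" for j
        unfolding A_def Hom_scaleR[OF P[OF that]] sum_distrib_left by (simp add: mult.left_commute)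
      then have "(\<Sum>j<n. of_real (s ^ j) * A j h) =
          (\<Sum>j<n. \<Sum>i\<in>UNIV. of_real (h $ i) * P i j (s *\<^sub>R h))"
        by simp
      also have "\<dots> = (\<Sum>i\<in>UNIV. \<Sum>j<n. of_real (h $ i) * P i j (s *\<^sub>R h))"
        by (rule sum.swap)
      finally have "\<phi>' s = (\<Sum>i\<in>UNIV. (h $ i) *\<^sub>R (D i (y + s *\<^sub>R h) - (\<Sum>j<n. P i j (s *\<^sub>R h))))"
        unfolding \<phi>'_def frechet_derivative_axis_sum[OF diff[OF inU[OF s]], of h] D_def
        by (simp add: scaleR_conv_of_real right_diff_distrib sum_subtractf sum_distrib_left)
      moreover have "norm ((h $ i) *\<^sub>R (D i (y + s *\<^sub>R h) - (\<Sum>j<n. P i j (s *\<^sub>R h))))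
          \<le> norm h * (\<bar>C i\<bar> * norm h ^ n)" for i
      proof -
        have "norm (D i (y + s *\<^sub>R h) - (\<Sum>j<n. P i j (s *\<^sub>R h))) \<le> C i * norm (s *\<^sub>R h) ^ n"
          using sh[OF s] h R(3)[of i] by (intro bound) linarith
        also have "\<dots> \<le> \<bar>C i\<bar> * norm h ^ n"
          using sh[OF s] by (intro mult_mono power_mono) auto
        finally show ?thesis
          unfolding norm_scaleR by (intro mult_mono component_le_norm_cart) auto
      qed
      ultimately have "norm (\<phi>' s) \<le> (\<Sum>i\<in>UNIV. norm h * (\<bar>C i\<bar> * norm h ^ n))"
        by (simp add: sum_norm_le)
      then show ?thesis
        by (simp add: sum_distrib_left sum_distrib_right algebra_simps)
    qed
    then have "onorm (\<lambda>t. t *\<^sub>R \<phi>' s) \<le> ?B" if "s \<in> {0..1}" for s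
      using that by (intro onorm_le) (metis mult.commute mult_left_mono norm_ge_zero norm_scaleR real_norm_def)
    from differentiable_bound[of "{0..1}", OF _ der this, of 1 0]
    have "norm (\<phi> 1 - \<phi> 0) \<le> ?B"
      by simp
    moreover have "\<phi> 0 = F y"
      by (simp add: \<phi>_def)
    moreover have "(\<Sum>j<Suc n. Q j h) = F y + (\<Sum>j<n. of_real (1 ^ Suc j / real (Suc j)) * A j h)"
      unfolding sum.lessThan_Suc_shift by (simp add: Q_def)
    ultimately show ?thesis
      by (simp add: \<phi>_def algebra_simps)
  qed
  with R(1) Q show ?case by blast
qed

section \<open>Local approximation by homogeneous polynomials\<close>

text \<open>The filter consists of neighbourhoods within the sphere that include the centre, so for
  \<open>y\<close> on the sphere the values at \<open>y\<close> must agree. The order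
  \<open>Suc m\<close> of the error is tied to the degree \<open>m\<close>, so that one parameter
  governs the recursion.\<close>

definition Hom_approx :: "nat \<Rightarrow> real ^ 'd \<Rightarrow> (real ^ 'd \<Rightarrow> 'k::real_normed_field) \<Rightarrow> bool" where
  "Hom_approx m y g \<longleftrightarrow> (\<exists>q \<in> Hom m.
     (\<lambda>z. g z - q z) \<in> O[inf (nhds y) (principal (sphere 0 1))](\<lambda>z. of_real (norm (z - y)) ^ Suc m))"

text \<open>Only values on the sphere enter, so \<open>g\<close> may be rewritten by identities that
  hold merely for unit vectors.\<close>

lemma Hom_approx_cong:
  assumes "Hom_approx m y g" "\<And>z. norm z = 1 \<Longrightarrow> g' z = g z"
  shows "Hom_approx m y g'"
proof -
  obtain q where q: "q \<in> Hom m"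
    "(\<lambda>z. g z - q z) \<in> O[inf (nhds y) (principal (sphere 0 1))](\<lambda>z. of_real (norm (z - y)) ^ Suc m)"
    using assms(1) unfolding Hom_approx_def by blast
  have "eventually (\<lambda>z. g' z - q z = g z - q z) (inf (nhds y) (principal (sphere 0 1)))"
    unfolding eventually_inf_principal using assms(2) by (simp add: always_eventually)
  from landau_o.big.in_cong[OF this] q show ?thesis
    unfolding Hom_approx_def by blast
qed

lemma Hom_approx_Hom: "q \<in> Hom m \<Longrightarrow> Hom_approx m y q"
  unfolding Hom_approx_def by (rule bexI) simp_all

lemma Hom_approx_bigo:
  "g \<in> O[inf (nhds y) (principal (sphere 0 1))](\<lambda>z. of_real (norm (z - y)) ^ Suc m) \<Longrightarrow>
    Hom_approx m y g"
  unfolding Hom_approx_def by (rule bexI[OF _ Hom_zero]) simp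

lemma Hom_approx_add:
  assumes "Hom_approx m y g" "Hom_approx m y g'"
  shows "Hom_approx m y (\<lambda>z. g z + g' z)"
proof -
  obtain q q' where q: "q \<in> Hom m" "q' \<in> Hom m"
    "(\<lambda>z. g z - q z) \<in> O[inf (nhds y) (principal (sphere 0 1))](\<lambda>z. of_real (norm (z - y)) ^ Suc m)"
    "(\<lambda>z. g' z - q' z) \<in> O[inf (nhds y) (principal (sphere 0 1))](\<lambda>z. of_real (norm (z - y)) ^ Suc m)"
    using assms unfolding Hom_approx_def by blast
  show ?thesis
    unfolding Hom_approx_def
    by (rule bexI[OF _ Hom_add[OF q(1,2)]]) (use sum_in_bigo(1)[OF q(3,4)] in \<open>simp add: algebra_simps\<close>)
qed

lemma Hom_approx_mult_const:
  assumes "Hom_approx m y g"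
  shows "Hom_approx m y (\<lambda>z. a * g z)"
proof -
  obtain q where q: "q \<in> Hom m"
    "(\<lambda>z. g z - q z) \<in> O[inf (nhds y) (principal (sphere 0 1))](\<lambda>z. of_real (norm (z - y)) ^ Suc m)"
    using assms unfolding Hom_approx_def by blast
  have "(\<lambda>z. a * (g z - q z)) \<in> O[inf (nhds y) (principal (sphere 0 1))](\<lambda>z. of_real (norm (z - y)) ^ Suc m)"
    using q(2) by (cases "a = 0") auto
  then show ?thesis
    unfolding Hom_approx_def
    by (intro bexI[OF _ Hom_mult_const[OF q(1)]]) (simp add: right_diff_distrib)
qed

lemma Hom_approx_diff:
  "Hom_approx m y g \<Longrightarrow> Hom_approx m y g' \<Longrightarrow> Hom_approx m y (\<lambda>z. g z - g' z)"
  using Hom_approx_add[of m y g "\<lambda>z. - 1 * g' z"] Hom_approx_mult_const[of m y g' "- 1"] by simp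

lemma Hom_approx_sum:
  "(\<And>i. i \<in> I \<Longrightarrow> Hom_approx m y (g i)) \<Longrightarrow> Hom_approx m y (\<lambda>z. \<Sum>i\<in>I. g i z)"
  by (induction I rule: infinite_finite_induct)
    (auto intro: Hom_approx_add Hom_approx_Hom[OF Hom_zero])

text \<open>A linear form that vanishes at \<open>y\<close> is homogeneous of degree one and also
  O(|z - y|), so the degree and the order of the error rise together.\<close>

lemma Hom_approx_inner_mult:
  assumes "Hom_approx m y g" "v \<bullet> y = 0"
  shows "Hom_approx (Suc m) y (\<lambda>z. of_real (v \<bullet> z) * g z)"
proof -
  obtain q where q: "q \<in> Hom m"
    "(\<lambda>z. g z - q z) \<in> O[inf (nhds y) (principal (sphere 0 1))](\<lambda>z. of_real (norm (z - y)) ^ Suc m)"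
    using assms(1) unfolding Hom_approx_def by blast
  have "\<bar>v \<bullet> z\<bar> \<le> norm v * norm (z - y)" for z
    using Cauchy_Schwarz_ineq2[of v "z - y"] assms(2) by (simp add: inner_diff_right)
  then have "(\<lambda>z. of_real (v \<bullet> z)) \<in> O[inf (nhds y) (principal (sphere 0 1))](\<lambda>z. of_real (norm (z - y)))"
    by (intro bigoI[of _ "norm v"] always_eventually) simp
  from landau_o.big.mult[OF this q(2)] show ?thesis
    unfolding Hom_approx_def
    by (intro bexI[OF _ Hom_inner_mult[OF q(1), of v]]) (simp add: right_diff_distrib)
qed

section \<open>Homogeneous polynomials in z - y\<close>

lemma bigo_Hom_translate:
  assumes "p \<in> Hom j" "Suc m \<le> j"
  shows "(\<lambda>z. p (z - y)) \<in> O[inf (nhds y) (principal (sphere 0 1))](\<lambda>z. of_real (norm (z - y)) ^ Suc m)"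
proof -
  obtain C where C: "\<And>x. norm (p x) \<le> C * norm x ^ j"
    using Hom_norm_le[OF assms(1)] by blast
  have "eventually (\<lambda>z. dist z y < 1) (nhds y)"
    unfolding eventually_nhds_metric by (intro exI[of _ 1]) auto
  then have "eventually (\<lambda>z. norm (p (z - y)) \<le> \<bar>C\<bar> * norm (of_real (norm (z - y)) ^ Suc m :: 'b))
      (inf (nhds y) (principal (sphere 0 1)))"
    unfolding eventually_inf_principal
  proof (rule eventually_mono, intro impI)
    fix z assume "dist z y < 1"
    then have "norm (z - y) ^ j \<le> norm (z - y) ^ Suc m"
      using assms(2) by (intro power_decreasing) (auto simp: dist_norm)
    then have "C * norm (z - y) ^ j \<le> \<bar>C\<bar> * norm (z - y) ^ Suc m"
      by (intro mult_mono) auto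
    with C[of "z - y"] show "norm (p (z - y)) \<le> \<bar>C\<bar> * norm (of_real (norm (z - y)) ^ Suc m :: 'b)"
      by (simp add: norm_power norm_mult)
  qed
  then show ?thesis by (rule bigoI)
qed

lemma Hom_inner_power: "(\<lambda>z. of_real (v \<bullet> z) ^ m) \<in> Hom m"
proof (induction m)
  case (Suc m)
  from Hom_inner_mult[OF this, of v] show ?case by simp
qed (simp add: Hom_const)

lemma Hom_norm_sq_power: "(\<lambda>x. of_real ((norm x)\<^sup>2) ^ i) \<in> Hom (2 * i)"
proof (induction i)
  case (Suc i)
  from Hom_norm_sq_mult[OF this] show ?case by simp
qed (simp add: Hom_const)

lemma norm_sq_diff_unit:
  fixes y z :: "'a::real_inner"
  assumes "norm y = 1" "norm z = 1"
  shows "(norm (z - y))\<^sup>2 = 2 - 2 * (y \<bullet> z)"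
  using assms by (simp add: power2_norm_eq_inner inner_diff inner_commute norm_eq_1)

text \<open>The hypothesis \<open>pos\<close> supplies the terms of higher degree in z - y, which
  the recursion handles before the constant.\<close>

lemma Hom_approx_const:
  fixes y :: "real ^ 'd::finite" and c :: "'k::real_normed_field"
  assumes y: "norm y = 1"
    and pos: "\<And>i. i > 0 \<Longrightarrow> Hom_approx m y (\<lambda>z. of_real ((norm (z - y))\<^sup>2) ^ i :: 'k)"
  shows "Hom_approx m y (\<lambda>z. c)"
proof -
  \<comment> \<open>These are the coefficients of c (1 - |z - y|^2 / 2)^m, which equals c <y, z>^m
    on the sphere. The term for \<open>i = 0\<close> is \<open>c\<close> itself; it is left out of
    the sum below, and the identity is solved for it.\<close>
  define a where "a i = of_nat (m choose i) * of_real (- 1 / 2) ^ i * c" for i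
  have sum: "Hom_approx m y (\<lambda>z. \<Sum>i\<in>{1..m}. a i * of_real ((norm (z - y))\<^sup>2) ^ i)"
  proof (rule Hom_approx_sum)
    fix i assume "i \<in> {1..m}"
    then have "i > 0" by simp
    from pos[OF this] show "Hom_approx m y (\<lambda>z. a i * of_real ((norm (z - y))\<^sup>2) ^ i)"
      by (rule Hom_approx_mult_const)
  qed
  have power: "Hom_approx m y (\<lambda>z. c * of_real (y \<bullet> z) ^ m)"
    by (rule Hom_approx_mult_const[OF Hom_approx_Hom[OF Hom_inner_power]])
  show ?thesis
  proof (rule Hom_approx_cong[OF Hom_approx_diff[OF power sum]])
    fix z :: "real ^ 'd" assume z: "norm z = 1"
    define s :: 'k where "s = of_real ((norm (z - y))\<^sup>2)"
    have "y \<bullet> z = - 1 / 2 * (norm (z - y))\<^sup>2 + 1"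
      unfolding norm_sq_diff_unit[OF y z] by (simp add: field_simps)
    then have "of_real (y \<bullet> z) = of_real (- 1 / 2) * s + 1"
      unfolding s_def by (simp only: of_real_add of_real_mult of_real_1)
    then have "c * of_real (y \<bullet> z) ^ m = c * (\<Sum>i\<le>m. of_nat (m choose i) * (of_real (- 1 / 2) * s) ^ i)"
      by (simp only: binomial_ring power_one mult_1_right)
    also have "\<dots> = (\<Sum>i\<le>m. a i * s ^ i)"
      unfolding sum_distrib_left a_def power_mult_distrib by (simp only: mult_ac)
    also have "{..m} = insert 0 {1..m}" by auto
    finally show "c = c * of_real (y \<bullet> z) ^ m - (\<Sum>i\<in>{1..m}. a i * of_real ((norm (z - y))\<^sup>2) ^ i)"
      unfolding s_def[symmetric] by (simp add: a_def)
  qed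
qed

text \<open>The hypotheses sit at different levels: the tangential part of the coordinate is linear
  in z and lifts \<open>g\<close> from \<open>m\<close> to \<open>Suc m\<close>, while the normal
  part only brings in |z - y|^2, so \<open>sq\<close> must already hold at
  \<open>Suc m\<close>.\<close>

lemma Hom_approx_coord_mult:
  fixes g :: "real ^ 'd::finite \<Rightarrow> 'k::real_normed_field"
  assumes y: "norm y = 1" and "Hom_approx m y g"
    and sq: "Hom_approx (Suc m) y (\<lambda>z. of_real ((norm (z - y))\<^sup>2) * g z)"
  shows "Hom_approx (Suc m) y (\<lambda>z. of_real ((z - y) $ i) * g z)"
proof -
  \<comment> \<open>This is the projection of the \<open>i\<close>-th unit vector onto the
    orthogonal complement of \<open>y\<close>. The remaining normal part of z - y has
    \<open>i\<close>-th coordinate - y_i (1 - <y, z>) = - y_i |z - y|^2 / 2.\<close>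
  define v where "v = axis i 1 - (y $ i) *\<^sub>R y"
  have "v \<bullet> y = 0"
    using y by (simp add: v_def inner_diff_left inner_axis' norm_eq_1)
  from Hom_approx_inner_mult[OF assms(2) this]
  have "Hom_approx (Suc m) y (\<lambda>z. of_real (v \<bullet> z) * g z -
      of_real (y $ i / 2) * (of_real ((norm (z - y))\<^sup>2) * g z))"
    by (rule Hom_approx_diff[OF _ Hom_approx_mult_const[OF sq]])
  then show ?thesis
  proof (rule Hom_approx_cong)
    fix z :: "real ^ 'd" assume z: "norm z = 1"
    have "(z - y) $ i = v \<bullet> z - y $ i / 2 * (norm (z - y))\<^sup>2"
      unfolding norm_sq_diff_unit[OF y z]
      by (simp add: v_def inner_diff_left inner_axis' algebra_simps)
    then have "of_real ((z - y) $ i) = (of_real (v \<bullet> z) - of_real (y $ i / 2) * of_real ((norm (z - y))\<^sup>2) :: 'k)"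
      by (simp only: of_real_diff of_real_mult)
    then show "of_real ((z - y) $ i) * g z = of_real (v \<bullet> z) * g z
        - of_real (y $ i / 2) * (of_real ((norm (z - y))\<^sup>2) * g z)"
      by (simp only: left_diff_distrib mult.assoc)
  qed
qed

text \<open>Each reduction lowers \<open>m\<close> or raises \<open>j\<close> with \<open>m\<close>
  fixed, and it ends at \<open>j > m\<close>, where the polynomial itself is within the permitted
  error. Hence the outer induction is on \<open>m\<close> and the inner one on
  \<open>Suc m - j\<close>.\<close>

lemma Hom_approx_translate:
  fixes p :: "real ^ 'd::finite \<Rightarrow> 'k::real_normed_field"
  assumes y: "norm y = 1" and "p \<in> Hom j"
  shows "Hom_approx m y (\<lambda>z. p (z - y))"
  using assms(2)
proof (induction m arbitrary: j p rule: less_induct)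
  case (less m)
  from less.prems show ?case
  proof (induction "Suc m - j" arbitrary: j p rule: less_induct)
    case IH: less
    \<comment> \<open>The condition \<open>j \<le> m\<close> makes the truncated measure
      \<open>Suc m - j\<close> really decrease.\<close>
    have higher: "Hom_approx m y (\<lambda>z. q (z - y))" if "q \<in> Hom k" "k > j" "j \<le> m"
      for q :: "real ^ 'd \<Rightarrow> 'k" and k
      by (rule IH.hyps[OF _ that(1)]) (use that(2,3) in linarith)
    consider "Suc m \<le> j" | "j = 0" | "0 < j" "j \<le> m"
      by linarith
    then show ?case
    proof cases
      case 1
      then show ?thesis
        by (rule Hom_approx_bigo[OF bigo_Hom_translate[OF IH.prems]])
    next
      case 2
      \<comment> \<open>In degree 0, scaling the argument by 0 does not change the value, because
        0^0 = 1; so \<open>p\<close> is constant.\<close>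
      have p: "(\<lambda>z. p (z - y)) = (\<lambda>z. p 0)"
      proof
        fix z
        show "p (z - y) = p 0"
          using Hom_scaleR[OF IH.prems, of 0 "z - y"] 2 by simp
      qed
      show ?thesis
        unfolding p
      proof (rule Hom_approx_const[OF y])
        fix i :: nat assume "i > 0"
        then show "Hom_approx m y (\<lambda>z. of_real ((norm (z - y))\<^sup>2) ^ i :: 'k)"
          using higher[OF Hom_norm_sq_power[of i]] 2 by simp
      qed
    next
      case 3
      then obtain k where k: "m = Suc k"
        by (cases m) auto
      \<comment> \<open>\<open>Hom_induct\<close> varies the degree, so it is tied to
        \<open>j\<close> by an implication; this keeps the inner induction hypothesis, which
        concerns the fixed \<open>j\<close>, applicable.\<close>
      have "l = j \<longrightarrow> Hom_approx m y (\<lambda>z. q (z - y))" if "q \<in> Hom l"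
        for q :: "real ^ 'd \<Rightarrow> 'k" and l
        using that
      proof (induction rule: Hom_induct)
        case (const c)
        then show ?case using 3 by simp
      next
        case (coord l i q)
        show ?case
        proof
          assume l: "Suc l = j"
          \<comment> \<open>The cofactor \<open>q\<close> is needed only at the lower level
            \<open>k\<close>, where the outer induction applies. Its product with |z - y|^2 has
            degree \<open>j + 1\<close> and falls under the inner one.\<close>
          have "Hom_approx k y (\<lambda>z. q (z - y))"
            by (rule less.IH[OF _ coord(1)]) (simp add: k)
          moreover have "Hom_approx m y (\<lambda>z. of_real ((norm (z - y))\<^sup>2) * q (z - y))"
            by (rule higher[OF Hom_norm_sq_mult[OF coord(1)]]) (use l 3 in auto)
          ultimately show "Hom_approx m y (\<lambda>z. of_real ((z - y) $ i) * q (z - y))"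
            unfolding k by (rule Hom_approx_coord_mult[OF y])
        qed
      next
        case (add l p q)
        then show ?case by (simp add: Hom_approx_add)
      qed
      with IH.prems show ?thesis by blast
    qed
  qed
qed

text \<open>Taylor's formula for a local extension \<open>F\<close> leaves an error of order
  \<open>Suc L\<close>, which is negligible, and each homogeneous Taylor term in z - y is covered by
  \<open>Hom_approx_translate\<close>.\<close>

lemma Hom_approx_C_sphere:
  fixes f :: "real ^ 'd::finite \<Rightarrow> 'k::real_normed_field"
  assumes "f \<in> C_sphere (Suc L)" "norm y = 1"
  shows "Hom_approx L y f"
proof -
  have "y \<in> sphere 0 1"
    using assms(2) by simp
  then have "\<exists>U F. open U \<and> y \<in> U \<and> Ck_on (Suc L) U F \<and> (\<forall>x\<in>U \<inter> sphere 0 1. F x = f x)"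
    using assms(1) unfolding C_sphere_def mem_Collect_eq by (elim conjE bspec)
  then obtain U F where U: "open U" "y \<in> U" "Ck_on (Suc L) U F" "\<forall>x\<in>U \<inter> sphere 0 1. F x = f x"
    by (elim exE conjE)
  obtain P C r where r: "r > 0" and P: "\<And>j. j < Suc L \<Longrightarrow> P j \<in> Hom j"
    and bound: "\<And>h. norm h < r \<Longrightarrow> norm (F (y + h) - (\<Sum>j<Suc L. P j h)) \<le> C * norm h ^ Suc L"
    using Taylor_Hom[OF U(3,1,2)] by blast
  have "eventually (\<lambda>z. z \<in> U \<and> dist z y < r) (nhds y)"
    using eventually_nhds_in_open[OF U(1,2)] eventually_nhds_in_open[OF open_ball, of y y r] r
    by (auto simp: dist_commute elim: eventually_elim2)
  then have "eventually (\<lambda>z. norm (f z - (\<Sum>j<Suc L. P j (z - y))) \<le>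
      C * norm (of_real (norm (z - y)) ^ Suc L :: 'k)) (inf (nhds y) (principal (sphere 0 1)))"
    unfolding eventually_inf_principal
  proof (rule eventually_mono, intro impI)
    fix z assume z: "z \<in> U \<and> dist z y < r" "z \<in> sphere 0 1"
    then have "F z = f z"
      using U(4) by blast
    then show "norm (f z - (\<Sum>j<Suc L. P j (z - y))) \<le> C * norm (of_real (norm (z - y)) ^ Suc L :: 'k)"
      using bound[of "z - y"] z(1) by (simp add: dist_norm norm_mult norm_power)
  qed
  then have "Hom_approx L y (\<lambda>z. f z - (\<Sum>j<Suc L. P j (z - y)))"
    by (intro Hom_approx_bigo bigoI)
  moreover have "Hom_approx L y (\<lambda>z. \<Sum>j<Suc L. P j (z - y))"
    by (rule Hom_approx_sum) (use Hom_approx_translate[OF assms(2) P] in simp)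
  ultimately have "Hom_approx L y (\<lambda>z. (f z - (\<Sum>j<Suc L. P j (z - y))) + (\<Sum>j<Suc L. P j (z - y)))"
    by (rule Hom_approx_add)
  then show ?thesis by simp
qed

section \<open>Spherical caps and the error bound\<close>

lemma norm_diff_le_arccos:
  fixes y z :: "'a::real_inner"
  assumes "norm y = 1" "norm z = 1"
  shows "norm (z - y) \<le> arccos (y \<bullet> z)"
proof -
  define \<theta> where "\<theta> = arccos (y \<bullet> z)"
  have inner: "\<bar>y \<bullet> z\<bar> \<le> 1"
    using Cauchy_Schwarz_ineq2[of y z] assms by simp
  then have \<theta>: "0 \<le> \<theta>" "cos (2 * (\<theta> / 2)) = y \<bullet> z"
    by (simp_all add: \<theta>_def arccos_lbound cos_arccos_abs abs_le_iff)
  \<comment> \<open>The chord of an arc of length \<theta> has length 2 sin(\<theta> / 2), which is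
    at most \<theta>.\<close>
  have "(norm (z - y))\<^sup>2 = (2 * sin (\<theta> / 2))\<^sup>2"
    unfolding norm_sq_diff_unit[OF assms] \<theta>(2)[symmetric] cos_double_sin by (simp add: power_mult_distrib)
  also have "\<dots> \<le> \<theta>\<^sup>2"
    using abs_sin_x_le_abs_x[of "\<theta> / 2"] by (intro power2_le_iff_abs_le[THEN iffD2]) (use \<theta>(1) in auto)
  finally show ?thesis
    using \<theta>(1) power2_le_imp_le unfolding \<theta>_def by blast
qed

text \<open>Suprema in the reals are meaningful only for sets bounded above, so every competitor in
  the infimum has to be bounded.\<close>

lemma H2_bounded:
  fixes g :: "real ^ 'd::finite \<Rightarrow> 'k::real_normed_field"
  assumes "g \<in> H2 L"
  shows "bounded (g ` sphere 0 1)"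
proof -
  obtain h where g: "g = restrict (\<lambda>x. \<Sum>l | l \<le> L \<and> l mod 2 = L mod 2. h l x) (sphere 0 1)"
    and h: "\<And>l. l \<le> L \<and> l mod 2 = L mod 2 \<Longrightarrow> h l \<in> Harm l"
    using assms unfolding H2_def by blast
  have "continuous_on (sphere 0 1) (h l)" if l: "l \<le> L \<and> l mod 2 = L mod 2" for l
  proof -
    obtain q where q: "h l = restrict q (sphere 0 1)" "q \<in> Hom l"
      using h[OF l] unfolding Harm_def by blast
    show ?thesis
      by (rule continuous_on_eq[OF continuous_on_Hom[OF q(2)]]) (simp add: q(1))
  qed
  then have "continuous_on (sphere 0 1) (\<lambda>x. \<Sum>l | l \<le> L \<and> l mod 2 = L mod 2. h l x)"
    by (intro continuous_on_sum) simp
  then have "continuous_on (sphere 0 1) g"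
    by (rule continuous_on_eq) (simp add: g)
  then show ?thesis
    by (intro compact_imp_bounded compact_continuous_image compact_sphere)
qed

text \<open>The scalar field stays generic, so that the real and the complex statement are both
  instances.\<close>

lemma best_approx_error_bigo:
  fixes f :: "real ^ 'd::finite \<Rightarrow> 'k::real_normed_field"
  assumes f: "f \<in> C_sphere (L + 1)" and y: "y \<in> sphere 0 1"
  shows "(\<lambda>\<delta>. best_approx_error \<delta> (H2 L) f y) \<in> O[at_right 0](\<lambda>\<delta>. \<delta> ^ (L + 1))"
proof -
  have y1: "norm y = 1" using y by simp
  obtain q where q: "q \<in> Hom L"
    "(\<lambda>z. f z - q z) \<in> O[inf (nhds y) (principal (sphere 0 1))](\<lambda>z. of_real (norm (z - y)) ^ Suc L)"
    using Hom_approx_C_sphere[of f L, OF _ y1] f unfolding Hom_approx_def by auto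
  from landau_o.bigE[OF q(2)] obtain C where "C > 0" and
    "eventually (\<lambda>z. norm (f z - q z) \<le> C * norm (of_real (norm (z - y)) ^ Suc L :: 'k))
      (inf (nhds y) (principal (sphere 0 1)))" by blast
  then obtain r where r: "r > 0"
    "\<And>z. norm z = 1 \<Longrightarrow> dist z y < r \<Longrightarrow> norm (f z - q z) \<le> C * norm (z - y) ^ Suc L"
    unfolding eventually_inf_principal eventually_nhds_metric
    by (auto simp: norm_power norm_mult)
  define q' where "q' = restrict q (sphere 0 1)"
  have q': "q' \<in> H2 L"
    unfolding q'_def by (rule restrict_Hom_in_H2[OF q(1)])
  have "norm (best_approx_error \<delta> (H2 L) f y) \<le> C * norm (\<delta> ^ (L + 1))" if \<delta>: "0 < \<delta>" "\<delta> < r" for \<delta>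
  proof -
    have "y \<in> cap \<delta> y"
      using y1 \<delta>(1) by (simp add: cap_def norm_eq_1)
    have bound: "norm (f z - q' z) \<le> C * \<delta> ^ (L + 1)" if "z \<in> cap \<delta> y" for z
    proof -
      have z: "norm z = 1" "norm (z - y) < \<delta>"
        using that norm_diff_le_arccos[OF y1, of z] by (auto simp: cap_def)
      then have "norm (f z - q z) \<le> C * norm (z - y) ^ Suc L"
        using r(2) \<delta>(2) by (simp add: dist_norm)
      also have "\<dots> \<le> C * \<delta> ^ Suc L"
        using z \<open>C > 0\<close> by (intro mult_left_mono power_mono) auto
      finally show ?thesis
        using z(1) by (simp add: q'_def)
    qed
    \<comment> \<open>This is shown for all competitors, not only for \<open>q'\<close>: the lower
      bound 0 allows the infimum to be compared with the error of \<open>q'\<close>, and it makes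
      the infimum equal to its absolute value.\<close>
    have nonneg: "0 \<le> (SUP z\<in>cap \<delta> y. norm (f z - g z))" if g: "g \<in> H2 L" for g
    proof -
      obtain B B' where B: "\<forall>z\<in>sphere 0 1. norm (g z) \<le> B" "\<forall>z\<in>sphere 0 1. norm (q' z) \<le> B'"
        using H2_bounded[OF g] H2_bounded[OF q'] unfolding bounded_iff by auto
      \<comment> \<open>On the cap \<open>f\<close> is controlled by its distance from
        \<open>q'\<close>, so bounds for \<open>q'\<close> and \<open>g\<close> suffice.\<close>
      have "norm (f z - g z) \<le> C * \<delta> ^ (L + 1) + (B' + B)" if "z \<in> cap \<delta> y" for z
      proof -
        have z: "z \<in> sphere 0 1" using that by (simp add: cap_def)
        have "norm (f z - g z) \<le> norm (f z - q' z) + norm (q' z - g z)"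
          using norm_triangle_ineq[of "f z - q' z" "q' z - g z"] by simp
        also have "norm (q' z - g z) \<le> norm (q' z) + norm (g z)"
          by (rule norm_triangle_ineq4)
        finally show ?thesis
          using bound[OF that] B(1)[rule_format, OF z] B(2)[rule_format, OF z] by linarith
      qed
      then have "bdd_above ((\<lambda>z. norm (f z - g z)) ` cap \<delta> y)"
        by (rule bdd_aboveI2)
      from cSUP_upper[OF \<open>y \<in> cap \<delta> y\<close> this] show ?thesis
        using norm_ge_zero order_trans by blast
    qed
    have "best_approx_error \<delta> (H2 L) f y \<le> (SUP z\<in>cap \<delta> y. norm (f z - q' z))"
      unfolding best_approx_error_def by (rule cINF_lower[OF bdd_belowI2[OF nonneg] q'])
    also have "\<dots> \<le> C * \<delta> ^ (L + 1)"
      using \<open>y \<in> cap \<delta> y\<close> bound by (intro cSUP_least) auto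
    finally have "best_approx_error \<delta> (H2 L) f y \<le> C * \<delta> ^ (L + 1)" .
    moreover have "0 \<le> best_approx_error \<delta> (H2 L) f y"
      unfolding best_approx_error_def using q' nonneg by (intro cINF_greatest) auto
    ultimately show ?thesis
      using \<delta>(1) by simp
  qed
  moreover have "eventually (\<lambda>\<delta>. 0 < \<delta> \<and> \<delta> < r) (at_right 0)"
    using eventually_at_right_less[of "0 :: real"] eventually_at_rightI[of 0 r "\<lambda>\<delta>. \<delta> < r"] r(1)
    by (auto intro: eventually_conj)
  ultimately show ?thesis
    by (intro bigoI[of _ C]) (auto elim: eventually_mono)
qed

theorem theorem3p9:
  fixes L :: nat
  assumes "CARD('d::finite) \<ge> 2"
  shows "(\<forall>f \<in> (C_sphere (L + 1) :: (real ^ 'd \<Rightarrow> real) set). \<forall>y \<in> sphere 0 1.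
            (\<lambda>\<delta>. best_approx_error \<delta> (H2 L) f y) \<in> O[at_right 0](\<lambda>\<delta>. \<delta> ^ (L + 1))) \<and>
         (\<forall>f \<in> (C_sphere (L + 1) :: (real ^ 'd \<Rightarrow> complex) set). \<forall>y \<in> sphere 0 1.
            (\<lambda>\<delta>. best_approx_error \<delta> (H2 L) f y) \<in> O[at_right 0](\<lambda>\<delta>. \<delta> ^ (L + 1)))"
  by (intro conjI ballI best_approx_error_bigo)

end
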